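(* Let $(A,\ast)$ be a composition algebra with involution $\ast$ over $\mathbf{k}$ and let $\alpha\colon A\to A$ be an algebra morphism that commutes with $\ast$ and preserves the multiplicative identity of $A$. Then $$M(A)_\alpha = (A,[,,]_\alpha,\alpha)$$ is a multiplicative ternary Hom-Maltsev algebra, where $$[xyz]_\alpha = \alpha((xy^* )z) - \langle y,z\rangle\alpha(x) + \langle x,z\rangle\alpha(y) - \langle x,y\rangle\alpha(z).$$ Moreover, if $\dim(A)\ge 5$ and $\alpha$ is injective, then $M(A)_\alpha$ is not a ternary Hom-Nambu-Lie algebra.
   Context: $\mathbf{k}$ is a fixed field of characteristic $0$. Let $A$ be a binary unital algebra over $\mathbf{k}$ (a $\mathbf{k}$-module with a bilinear, not necessarily associative, multiplication $xy$) with multiplicative identity $1$. An involution on $A$ is an anti-automorphism of order $2$, i.e., a linear automorphism $\ast\ne Id$ with $(x^* )^*=x$ and $(xy)^*=y^*x^*$ for all $x,y\in A$. $A$ is a composition algebra with involution $\ast$ if $\ast$ is an involution on $A$ such that (a) $xx^*=x^*x\in\mathbf{k}1$ for all $x\in A$, and (b) the symmetric bilinear form $\langle x,y\rangle=\frac12(xy^*+yx^* )\in\mathbf{k}1$ on $A$ is non-degenerate. Elements of $\mathbf{k}1$ are identified with scalars. For $n\ge 2$, an $n$-ary Hom-algebra $(V,[,\ldots,],(\alpha_1,\ldots,\alpha_{n-1}))$ is a $\mathbf{k}$-module $V$ with an $n$-linear map $[,\ldots,]\colon V^{\otimes n}\to V$ and linear maps $\alpha_i\colon V\to V$ (the twisting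 maps); ternary means $n=3$. If all twisting maps equal $\alpha$ it is written $(V,[,\ldots,],\alpha)$, and it is multiplicative if moreover $\alpha([x_1,\ldots,x_n])=[\alpha(x_1),\ldots,\alpha(x_n)]$. The product is anti-symmetric if $[x_1,\ldots,x_n]=\epsilon(\sigma)[x_{\sigma(1)},\ldots,x_{\sigma(n)}]$ for all permutations $\sigma$, with $\epsilon(\sigma)$ the sign. For ternary products $[xyz]$ means $[x,y,z]$. A ternary Hom-algebra with both twisting maps equal to $\alpha$ is a ternary Hom-Maltsev algebra if its product is anti-symmetric and for all $z,x_2,x_3,y_2,y_3$ $$\begin{aligned}0 &= \alpha\big([[z,x_2,x_3],[x_2,y_2,y_3],\alpha(x_3)]\big) + \alpha\big([[z,x_2,x_3],\alpha(x_2),[x_3,y_2,y_3]]\big)\\ &\quad + [[\alpha(z),[x_2,y_2,y_3],\alpha(x_3)],\alpha^2(x_2),\alpha^2(x_3)] + [[\alpha(z),\alpha(x_2),[x_3,y_2,y_3]],\alpha^2(x_2),\alpha^2(x_3)]\\ &\quad - [[[z,x_2,x_3],\alpha(x_2),\alpha(x_3)],\alpha^2(y_2),\alpha^2(y_3)] + [[[z,y_2,y_3],\alpha(x_2),\alpha(x_3)],\alpha^2(x_2),\alpha^2(x_3)].\end{aligned}$$ It is a ternary Hom-Nambu-Lie algebra if its product is anti-symmetric and for all $x,y,u,v,w$ $$[\alpha(x),\alpha(y),[u,v,w]] = [[x,y,u],\alpha(v),\alpha(w)] + [\alpha(u),[x,y,v],\alpha(w)] + [\alpha(u),\alpha(v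),[x,y,w]].$$
   Formalization: "Composition algebra" also assumes ⟨xy,xy⟩=⟨x,x⟩⟨y,y⟩; with (a), (b) only the claim fails: on k1+ku+kv with uu=vv=-1, uv=-vu=u, u*=-u, v*=-v and α=id, [uvv]=-2u≠0. *)

theory Defs
  imports Complex_Main "HOL-Combinatorics.Permutations"
begin

text \<open>
  Vector spaces are whole types carrying a scalar multiplication in the sense of the library
  locale \<^locale>\<open>vector_space\<close>; the ground field is any \<^class>\<open>field_char_0\<close>.
\<close>

section \<open>Ternary Hom-algebras\<close>

text \<open>Both twisting maps are equal to \<open>\<alpha>\<close>.\<close>

locale ternary_hom_algebra = vector_space scale
  for scale :: "'k::field_char_0 \<Rightarrow> 'v::ab_group_add \<Rightarrow> 'v" +
  fixes br :: "'v \<Rightarrow> 'v \<Rightarrow> 'v \<Rightarrow> 'v"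
    and \<alpha> :: "'v \<Rightarrow> 'v"
  assumes linear_br1: "Vector_Spaces.linear scale scale (\<lambda>x. br x y z)"
    and linear_br2: "Vector_Spaces.linear scale scale (\<lambda>y. br x y z)"
    and linear_br3: "Vector_Spaces.linear scale scale (\<lambda>z. br x y z)"
    and linear_twist: "Vector_Spaces.linear scale scale \<alpha>"

locale multiplicative_ternary_hom_algebra = ternary_hom_algebra +
  assumes twist_br: "\<alpha> (br x y z) = br (\<alpha> x) (\<alpha> y) (\<alpha> z)"

locale antisymmetric_ternary_hom_algebra = ternary_hom_algebra +
  assumes br_permute: "\<sigma> permutes {1, 2, 3::nat} \<Longrightarrow>
    br (x 1) (x 2) (x 3) = scale (of_int (sign \<sigma>)) (br (x (\<sigma> 1)) (x (\<sigma> 2)) (x (\<sigma> 3)))"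

locale ternary_hom_maltsev_algebra = antisymmetric_ternary_hom_algebra +
  assumes hom_maltsev:
    "0 = \<alpha> (br (br z x\<^sub>2 x\<^sub>3) (br x\<^sub>2 y\<^sub>2 y\<^sub>3) (\<alpha> x\<^sub>3))
       + \<alpha> (br (br z x\<^sub>2 x\<^sub>3) (\<alpha> x\<^sub>2) (br x\<^sub>3 y\<^sub>2 y\<^sub>3))
       + br (br (\<alpha> z) (br x\<^sub>2 y\<^sub>2 y\<^sub>3) (\<alpha> x\<^sub>3)) (\<alpha> (\<alpha> x\<^sub>2)) (\<alpha> (\<alpha> x\<^sub>3))
       + br (br (\<alpha> z) (\<alpha> x\<^sub>2) (br x\<^sub>3 y\<^sub>2 y\<^sub>3)) (\<alpha> (\<alpha> x\<^sub>2)) (\<alpha> (\<alpha> x\<^sub>3))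
       - br (br (br z x\<^sub>2 x\<^sub>3) (\<alpha> x\<^sub>2) (\<alpha> x\<^sub>3)) (\<alpha> (\<alpha> y\<^sub>2)) (\<alpha> (\<alpha> y\<^sub>3))
       + br (br (br z y\<^sub>2 y\<^sub>3) (\<alpha> x\<^sub>2) (\<alpha> x\<^sub>3)) (\<alpha> (\<alpha> x\<^sub>2)) (\<alpha> (\<alpha> x\<^sub>3))"

locale ternary_hom_nambu_lie_algebra = antisymmetric_ternary_hom_algebra +
  assumes hom_nambu:
    "br (\<alpha> x) (\<alpha> y) (br u v w) =
       br (br x y u) (\<alpha> v) (\<alpha> w) + br (\<alpha> u) (br x y v) (\<alpha> w) + br (\<alpha> u) (\<alpha> v) (br x y w)"


section \<open>Composition algebras with involution\<close>

locale unital_algebra = vector_space scale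
  for scale :: "'k::field_char_0 \<Rightarrow> 'a::ab_group_add \<Rightarrow> 'a" +
  fixes mul :: "'a \<Rightarrow> 'a \<Rightarrow> 'a"
    and e :: 'a
  assumes linear_mult_left: "Vector_Spaces.linear scale scale (\<lambda>x. mul x y)"
    and linear_mult_right: "Vector_Spaces.linear scale scale (\<lambda>y. mul x y)"
    and mult_unit_left: "mul e x = x"
    and mult_unit_right: "mul x e = x"

locale algebra_with_involution = unital_algebra scale mul e
  for scale :: "'k::field_char_0 \<Rightarrow> 'a::ab_group_add \<Rightarrow> 'a" and mul e +
  fixes ast :: "'a \<Rightarrow> 'a"
  assumes linear_ast: "Vector_Spaces.linear scale scale ast"
    and ast_neq_id: "ast \<noteq> id"
    and ast_ast: "ast (ast x) = x"
    and ast_mult: "ast (mul x y) = mul (ast y) (ast x)"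

text \<open>
  The scalar \<open>c\<close> with \<open>c e = (x y* + y x*)/2\<close>; see \<open>scale_inner\<close> below for existence and
  \<open>inner_eqI\<close> for uniqueness.
\<close>

definition inner_form ::
  "('k::field_char_0 \<Rightarrow> 'a::ab_group_add \<Rightarrow> 'a) \<Rightarrow> ('a \<Rightarrow> 'a \<Rightarrow> 'a) \<Rightarrow> 'a \<Rightarrow> ('a \<Rightarrow> 'a) \<Rightarrow>
    'a \<Rightarrow> 'a \<Rightarrow> 'k"
  where "inner_form scale mul e ast x y =
    (THE c. scale c e = scale (1/2) (mul x (ast y) + mul y (ast x)))"

text \<open>
  The axiom \<open>composition\<close> is the multiplicativity of the norm \<open>N x = \<langle>x, x\<rangle>\<close>, i.e.\ the property
  that the word "composition" refers to.  It does not follow from the other axioms: on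
  \<open>k e \<oplus> k u \<oplus> k v\<close> let \<open>uu = vv = -e\<close>, \<open>uv = -vu = u\<close>, \<open>e* = e\<close>, \<open>u* = -u\<close>, \<open>v* = -v\<close>.  All
  other axioms hold, but \<open>(u v*) v - \<langle>v, v\<rangle> u = -2u\<close>, so that the ternary product
  defined below (with \<open>\<alpha> = id\<close>) is not anti-symmetric.
\<close>

locale composition_algebra_with_involution = algebra_with_involution scale mul e ast
  for scale :: "'k::field_char_0 \<Rightarrow> 'a::ab_group_add \<Rightarrow> 'a" and mul e ast +
  assumes mult_ast_commute: "mul x (ast x) = mul (ast x) x"
    and mult_ast_scalar: "mul x (ast x) \<in> range (\<lambda>c. scale c e)"
    and nondegenerate: "(\<And>y. inner_form scale mul e ast x y = 0) \<Longrightarrow> x = 0"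
    and composition: "inner_form scale mul e ast (mul x y) (mul x y) =
      inner_form scale mul e ast x x * inner_form scale mul e ast y y"
begin

lemma unit_nonzero: "e \<noteq> 0"
proof
  assume "e = 0"
  then have "x = 0" for x :: 'a
    using mult_unit_left[of x] module_hom.zero[OF linear_mult_left[unfolded linear_iff_module_hom]]
    by simp
  then have "ast = id"
    by (metis ext)
  then show False
    using ast_neq_id by simp
qed

lemma inner_eqI:
  assumes "scale c e = scale (1/2) (mul x (ast y) + mul y (ast x))"
  shows "inner_form scale mul e ast x y = c"
  unfolding inner_form_def using assms unit_nonzero
  by (intro the_equality) (auto simp flip: assms)

lemma scale_inner:
  "scale (inner_form scale mul e ast x y) e = scale (1/2) (mul x (ast y) + mul y (ast x))"
proof -
  have add: "ast (x + y) = ast x + ast y" "mul (u + v) w = mul u w + mul v w"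
    "mul w (u + v) = mul w u + mul w v" for u v w
    using module_hom.add[OF linear_ast[unfolded linear_iff_module_hom]]
      module_hom.add[OF linear_mult_left[unfolded linear_iff_module_hom]]
      module_hom.add[OF linear_mult_right[unfolded linear_iff_module_hom]]
    by auto
  obtain a b c where "mul x (ast x) = scale a e" "mul y (ast y) = scale b e"
    "mul (x + y) (ast (x + y)) = scale c e"
    using mult_ast_scalar by blast
  then have "mul x (ast y) + mul y (ast x) = scale (c - a - b) e"
    by (simp add: add scale_left_diff_distrib algebra_simps)
  then have "scale ((1/2) * (c - a - b)) e = scale (1/2) (mul x (ast y) + mul y (ast x))"
    by simp
  then show ?thesis
    using inner_eqI by metis
qed

end

locale unital_involutive_morphism =
  algebra_with_involution scale mul e ast
  for scale :: "'k::field_char_0 \<Rightarrow> 'a::ab_group_add \<Rightarrow> 'a" and mul e ast +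
  fixes \<alpha> :: "'a \<Rightarrow> 'a"
  assumes linear_morph: "Vector_Spaces.linear scale scale \<alpha>"
    and morph_mult: "\<alpha> (mul x y) = mul (\<alpha> x) (\<alpha> y)"
    and morph_ast: "\<alpha> (ast x) = ast (\<alpha> x)"
    and morph_unit: "\<alpha> e = e"

definition twisted_bracket ::
  "('k::field_char_0 \<Rightarrow> 'a::ab_group_add \<Rightarrow> 'a) \<Rightarrow> ('a \<Rightarrow> 'a \<Rightarrow> 'a) \<Rightarrow> 'a \<Rightarrow> ('a \<Rightarrow> 'a) \<Rightarrow>
    ('a \<Rightarrow> 'a) \<Rightarrow> 'a \<Rightarrow> 'a \<Rightarrow> 'a \<Rightarrow> 'a"
  where "twisted_bracket scale mul e ast \<alpha> x y z =
      \<alpha> (mul (mul x (ast y)) z)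
    - scale (inner_form scale mul e ast y z) (\<alpha> x)
    + scale (inner_form scale mul e ast x z) (\<alpha> y)
    - scale (inner_form scale mul e ast x y) (\<alpha> z)"

text \<open>
  The library's \<open>dim\<close> is \<open>0\<close> on infinite-dimensional spaces, which must count as having
  dimension at least \<open>n\<close>.
\<close>

definition dim_at_least :: "('k::field \<Rightarrow> 'a::ab_group_add \<Rightarrow> 'a) \<Rightarrow> nat \<Rightarrow> bool"
  where "dim_at_least scale n \<longleftrightarrow>
    (\<exists>B. finite B \<and> module.span scale B = UNIV) \<longrightarrow> n \<le> vector_space.dim scale UNIV"

end

theory Submission
  imports Defs
begin

text \<open>
  For \<open>\<alpha> = id\<close> the product \<open>[x, y, z]\<close> is a ternary vector cross product: it is alternating,
  orthogonal to its arguments, and for fixed \<open>a\<close>, \<open>b\<close> the square of the operator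
  \<open>R = [\<cdot>, a, b]\<close> is determined by the symmetric form alone.  It kills \<open>a\<close> and \<open>b\<close> and is minus
  the Gram determinant of \<open>a\<close>, \<open>b\<close> on their orthogonal complement.  That a composition algebra
  satisfies these axioms (the sublocale \<open>cross\<close>) is a computation with the identities
  \<open>(x c) c* = (x c*) c = \<langle>c, c\<rangle> x\<close>, which follow from the multiplicativity of the norm.
  
  The Maltsev identity is then nearly formal (\<open>ternary_maltsev\<close>).  Put \<open>D = [\<cdot>, y\<^sub>2, y\<^sub>3]\<close>.
  The identity says that the commutator of \<open>D\<close> with \<open>R\<^sup>2\<close> is the derivative of \<open>R\<^sup>2\<close> when
  \<open>a\<close> and \<open>b\<close> move in the directions \<open>D a\<close> and \<open>D b\<close>.  As \<open>R\<^sup>2\<close> is a natural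
  expression in the form, this holds for every \<open>D\<close> that is an infinitesimal isometry, and
  \<open>D\<close> is one because \<open>\<langle>[x, y, z], w\<rangle>\<close> is alternating.
  
  In dimension at least 5 the Nambu identity fails (\<open>not_nambu_lie\<close>).  With one entry fixed to
  \<open>a\<close>, the product becomes a binary cross product \<open>u \<times> v = [u, v, a]\<close> on the complement of
  \<open>a\<close>, and Nambu becomes the Jacobi identity.  On pairwise orthogonal vectors
  \<open>(u \<times> b) \<times> c\<close> is alternating, so Jacobi reads \<open>3 (u \<times> b) \<times> c = 0\<close>.  A fifth dimension
  supplies \<open>c\<close> orthogonal to \<open>a\<close>, \<open>u\<close>, \<open>b\<close> and \<open>u \<times> b\<close>, for which this product does not
  vanish.
  
  Finally, \<open>\<alpha>\<close> preserves the form, because \<open>\<langle>x, y\<rangle> e\<close> is built from the product and the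
  involution and \<open>\<alpha>\<close> fixes \<open>e\<close>.  Hence it is an endomorphism of the cross product, and the
  bracket of the theorem is \<open>\<alpha> [x, y, z]\<close>.  Every term of the Hom-Maltsev identity is
  \<open>\<alpha>\<^sup>3\<close>, and every term of the Hom-Nambu identity \<open>\<alpha>\<^sup>2\<close>, of the corresponding
  untwisted term.
\<close>

lemma linear_homD:
  assumes "Vector_Spaces.linear s1 s2 f"
  shows "f (x + y) = f x + f y" "f (s1 c x) = s2 c (f x)" "f 0 = 0" "f (- x) = - f x"
    "f (x - y) = f x - f y"
proof -
  interpret Vector_Spaces.linear s1 s2 f by fact
  show "f (x + y) = f x + f y" "f (s1 c x) = s2 c (f x)" "f 0 = 0" "f (- x) = - f x"
    "f (x - y) = f x - f y"
    by (simp_all add: add scale neg diff)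
qed

section \<open>Ternary vector cross products\<close>

text \<open>
  The axiom \<open>br_twice\<close> replaces the usual normalization that the norm of \<open>[z, a, b]\<close> is the Gram
  determinant of \<open>z\<close>, \<open>a\<close>, \<open>b\<close>; since \<open>[\<cdot>, a, b]\<close> is skew-adjoint, the two are equivalent
  when the form is nondegenerate.  The operator form of the axiom is the one that can be
  differentiated directly.
\<close>

locale ternary_cross_product = vector_space scale
  for scale :: "'k::field_char_0 \<Rightarrow> 'v::ab_group_add \<Rightarrow> 'v" +
  fixes g :: "'v \<Rightarrow> 'v \<Rightarrow> 'k"
    and br :: "'v \<Rightarrow> 'v \<Rightarrow> 'v \<Rightarrow> 'v"
  assumes g_sym: "g x y = g y x"
    and linear_g: "Vector_Spaces.linear scale (*) (\<lambda>x. g x y)"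
    and linear_br1: "Vector_Spaces.linear scale scale (\<lambda>x. br x y z)"
    and linear_br2: "Vector_Spaces.linear scale scale (\<lambda>y. br x y z)"
    and linear_br3: "Vector_Spaces.linear scale scale (\<lambda>z. br x y z)"
    and br_same12: "br x x z = 0"
    and br_same23: "br x y y = 0"
    and br_orthogonal: "g (br x y z) x = 0"
    and br_twice: "br (br z a b) a b =
      scale (g a b * g a b - g a a * g b b) z
      + scale (g z a * g b b - g z b * g a b) a
      + scale (g z b * g a a - g z a * g a b) b"
begin

lemmas br_lin = linear_homD[OF linear_br1] linear_homD[OF linear_br2] linear_homD[OF linear_br3]

lemmas g_left = linear_homD[OF linear_g]

lemma g_right:
  "g x (y + z) = g x y + g x z" "g x (scale c y) = c * g x y" "g x 0 = 0" "g x (- y) = - g x y"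
  "g x (y - z) = g x y - g x z"
  by (simp_all add: g_sym[of x] g_left)

lemma br_swap12: "br y x z = - br x y z"
proof -
  have "br (x + y) (x + y) z = br x x z + br x y z + br y x z + br y y z"
    by (simp add: br_lin)
  then show ?thesis
    by (simp add: br_same12 eq_neg_iff_add_eq_0 add.commute)
qed

lemma br_swap23: "br x z y = - br x y z"
proof -
  have "br x (y + z) (y + z) = br x y y + br x y z + br x z y + br x z z"
    by (simp add: br_lin)
  then show ?thesis
    by (simp add: br_same23 eq_neg_iff_add_eq_0 add.commute)
qed

lemma br_swap13: "br z y x = - br x y z"
  using br_swap12[of z y x] br_swap23[of y x z] br_swap12[of y x z] by simp

lemma br_cyclic: "br y z x = br x y z"
  using br_swap12[of z y x] br_swap13[of z y x] by simp

lemma br_skew: "g (br x y z) w = - g x (br w y z)"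
proof -
  have "g (br (x + w) y z) (x + w) = g (br x y z) w + g (br w y z) x"
    by (simp add: br_lin g_left g_right br_orthogonal)
  then have "g (br x y z) w + g x (br w y z) = 0"
    by (simp add: br_orthogonal g_sym[of x "br w y z"])
  then show ?thesis
    by (simp add: eq_neg_iff_add_eq_0)
qed

text \<open>
  Transpositions generate the symmetric group, so the three exchange laws are enough.
\<close>

lemma br_permute:
  assumes "\<sigma> permutes {1, 2, 3::nat}"
  shows "br (x 1) (x 2) (x 3) = scale (of_int (sign \<sigma>)) (br (x (\<sigma> 1)) (x (\<sigma> 2)) (x (\<sigma> 3)))"
proof -
  have "finite {1, 2, 3::nat}"
    by simp
  from assms this show ?thesis
  proof (induction arbitrary: x rule: permutes_induct)
    case id
    then show ?case
      by simp
  next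
    case (swap a b p)
    define y where "y = x \<circ> transpose a b"
    have IH: "br (y 1) (y 2) (y 3) = scale (of_int (sign p)) (br (y (p 1)) (y (p 2)) (y (p 3)))"
      by (rule swap.IH)
    have transposed: "br (x 1) (x 2) (x 3) = scale (of_int (sign (transpose a b))) (br (y 1) (y 2) (y 3))"
      using swap.hyps br_swap12[of "x 1" "x 2" "x 3"] br_swap23[of "x 1" "x 2" "x 3"]
        br_swap13[of "x 1" "x 2" "x 3"]
      by (auto simp: y_def sign_swap_id transpose_def)
    have "sign (transpose a b \<circ> p) = sign (transpose a b) * sign p"
      using swap.hyps permutes_imp_permutation[of "{1, 2, 3::nat}" p]
      by (intro sign_compose permutation_swap_id) simp
    then show ?case
      unfolding transposed IH by (simp add: y_def del: comp_apply) simp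
  qed
qed

text \<open>
  The derivative of \<open>br_twice\<close> in the direction \<open>c\<close> of its argument \<open>a\<close>; exact because both sides
  are quadratic in \<open>a\<close>.
\<close>

lemma br_twice_polar:
  "br (br z a b) c b + br (br z c b) a b =
    scale (g a b * g c b + g c b * g a b - g a c * g b b - g a c * g b b) z
    + scale (g z a * g b b - g z b * g a b) c
    + scale (g z c * g b b - g z b * g c b) a
    + scale (g z b * g a c + g z b * g a c - g z a * g c b - g z c * g a b) b"
proof -
  have "br (br z a b) c b + br (br z c b) a b =
    br (br z (a + c) b) (a + c) b - br (br z a b) a b - br (br z c b) c b"
    by (simp add: br_lin)
  then show ?thesis
    unfolding br_twice
    by (simp add: g_left g_right g_sym algebra_simps scale_left_distrib scale_left_diff_distrib
        scale_right_distrib)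
qed

text \<open>
  The four terms in which \<open>D = [\<cdot>, y2, y3]\<close> hits \<open>a\<close> or \<open>b\<close> form the derivative of
  \<open>[[z, a, b], a, b]\<close> along \<open>a \<mapsto> D a\<close>, \<open>b \<mapsto> D b\<close>.  By \<open>br_twice\<close> all terms are combinations of
  \<open>z\<close>, \<open>a\<close>, \<open>b\<close> and their images under \<open>D\<close> with coefficients from the form, and these cancel
  since \<open>D\<close> is skew-adjoint.
\<close>

lemma ternary_maltsev:
  "br (br z a b) (br a y2 y3) b + br (br z a b) a (br b y2 y3)
    + br (br z (br a y2 y3) b) a b + br (br z a (br b y2 y3)) a b
    - br (br (br z a b) a b) y2 y3 + br (br (br z y2 y3) a b) a b = 0"
proof -
  define D where "D u = br u y2 y3" for u
  have D_lin: "D (u + v) = D u + D v" "D (scale c u) = scale c (D u)" for u v c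
    by (simp_all add: D_def br_lin)
  have skew: "g (D u) v = - g u (D v)" for u v
    by (simp add: D_def br_skew)
  have self: "g u (D u) = 0" for u
    using br_orthogonal[of u y2 y3] by (simp add: D_def g_sym)
  have in_a: "br (br z a b) (D a) b + br (br z (D a) b) a b =
    scale (g a b * g (D a) b + g (D a) b * g a b) z
    + scale (g z a * g b b - g z b * g a b) (D a)
    + scale (g z (D a) * g b b - g z b * g (D a) b) a
    + scale (- g z a * g (D a) b - g z (D a) * g a b) b"
    using br_twice_polar[of z a b "D a"] by (simp add: self)
  \<comment> \<open>Exchanging the last two entries of each of the two brackets reduces \<open>b\<close> to the case of \<open>a\<close>.\<close>
  have "br (br z a b) a (D b) + br (br z a (D b)) a b = br (br z b a) (D b) a + br (br z (D b) a) b a"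
    using br_swap23[of z a b] br_swap23[of z a "D b"] br_swap23[of "br z a b" a "D b"]
      br_swap23[of "br z a (D b)" a b]
    by (simp add: br_lin)
  also have "\<dots> = scale (g b a * g (D b) a + g (D b) a * g b a) z
    + scale (g z b * g a a - g z a * g b a) (D b)
    + scale (g z (D b) * g a a - g z a * g (D b) a) b
    + scale (- g z b * g (D b) a - g z (D b) * g b a) a"
    using br_twice_polar[of z b a "D b"] by (simp add: self)
  finally have in_b: "br (br z a b) a (D b) + br (br z a (D b)) a b = \<dots>" .
  have "(br (br z a b) (D a) b + br (br z (D a) b) a b)
      + (br (br z a b) a (D b) + br (br z a (D b)) a b)
      - D (br (br z a b) a b) + br (br (D z) a b) a b = 0"
    unfolding in_a in_b br_twice D_lin skew
    by (simp add: g_sym[of b a] g_sym[of b "D a"] skew algebra_simps)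
  then show ?thesis
    by (simp add: D_def algebra_simps)
qed

text \<open>
  The form may have isotropic vectors, so an arbitrary nonzero vector of the orthogonal complement
  will not do.  The complement inherits nondegeneracy, and by polarization a nonzero symmetric form
  has an anisotropic vector in characteristic other than 2.
\<close>

lemma exists_anisotropic_orthogonal:
  assumes nondegenerate: "\<And>x. (\<And>y. g x y = 0) \<Longrightarrow> x = 0"
    and "finite B" and not_spanning: "span B \<noteq> UNIV"
    and pairwise_orth: "\<And>x y. x \<in> B \<Longrightarrow> y \<in> B \<Longrightarrow> x \<noteq> y \<Longrightarrow> g x y = 0"
    and anisotropic: "\<And>x. x \<in> B \<Longrightarrow> g x x \<noteq> 0"
  obtains c where "g c c \<noteq> 0" "\<And>x. x \<in> B \<Longrightarrow> g x c = 0"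
proof -
  \<comment> \<open>The orthogonal projection onto the complement of \<open>B\<close>.\<close>
  define pr where "pr v = v - (\<Sum>x\<in>B. scale (g v x / g x x) x)" for v
  have g_sum: "g w (\<Sum>x\<in>B. h x) = (\<Sum>x\<in>B. g w (h x))" for w h
    using \<open>finite B\<close> by (induction rule: finite_induct) (simp_all add: g_right)
  have orth: "g b (pr v) = 0" if "b \<in> B" for b v
  proof -
    have "(\<Sum>x\<in>B. g b (scale (g v x / g x x) x)) = (\<Sum>x\<in>B. if x = b then g v b else 0)"
      using that pairwise_orth anisotropic by (intro sum.cong) (auto simp: g_right)
    also have "\<dots> = g v b"
      using \<open>finite B\<close> that by simp
    finally show ?thesis
      by (simp add: pr_def g_right g_sum g_sym)
  qed
  obtain v where v: "v \<notin> span B"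
    using not_spanning by blast
  have "pr v \<noteq> 0"
  proof
    assume "pr v = 0"
    then have "v = (\<Sum>x\<in>B. scale (g v x / g x x) x)"
      by (simp add: pr_def)
    also have "\<dots> \<in> span B"
      by (intro span_sum span_scale span_base)
    finally show False
      using v by simp
  qed
  then obtain y where y: "g (pr v) y \<noteq> 0"
    using nondegenerate by blast
  have pairing: "g (pr v) (pr y) = g (pr v) y"
  proof -
    have "(\<Sum>x\<in>B. g (pr v) (scale (g y x / g x x) x)) = 0"
      using orth by (intro sum.neutral) (simp add: g_right g_sym)
    then show ?thesis
      by (simp add: pr_def[of y] g_right g_sum)
  qed
  let ?s = "pr v + pr y"
  have "g ?s ?s = g (pr v) (pr v) + g (pr y) (pr y) + 2 * g (pr v) (pr y)"
    by (simp add: g_left g_right g_sym)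
  then consider "g (pr v) (pr v) \<noteq> 0" | "g (pr y) (pr y) \<noteq> 0" | "g ?s ?s \<noteq> 0"
    using y pairing by force
  then show thesis
  proof cases
    case 1
    then show thesis using that orth by blast
  next
    case 2
    then show thesis using that orth by blast
  next
    case 3
    moreover have "g b ?s = 0" if "b \<in> B" for b
      using orth that by (simp add: g_right)
    ultimately show thesis using that by blast
  qed
qed

text \<open>
  The vectors \<open>a\<close>, \<open>b\<close>, \<open>u\<close>, \<open>p = [u, b, a]\<close>, \<open>c\<close> are pairwise orthogonal and anisotropic.
  Then \<open>[p, c, a]\<close> vanishes by the Jacobi identity, while
  \<open>[[p, c, a], c, a] = - \<langle>a, a\<rangle> \<langle>c, c\<rangle> p\<close> does not.
\<close>

lemma not_nambu_lie:
  assumes nondegenerate: "\<And>x. (\<And>y. g x y = 0) \<Longrightarrow> x = 0"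
    and "dim_at_least scale 5"
    and nambu: "\<And>x y u v w.
      br x y (br u v w) = br (br x y u) v w + br u (br x y v) w + br u v (br x y w)"
  shows False
proof -
  have not_spanning: "span B \<noteq> UNIV" if "finite B" "card B < 5" for B
  proof
    assume "span B = UNIV"
    then have "5 \<le> dim (UNIV :: 'v set)"
      using \<open>dim_at_least scale 5\<close> \<open>finite B\<close> by (auto simp: dim_at_least_def)
    moreover have "dim (UNIV :: 'v set) \<le> card B"
      using \<open>span B = UNIV\<close> \<open>finite B\<close> by (intro dim_le_card) auto
    ultimately show False
      using that by simp
  qed
  have extend: "\<exists>c. g c c \<noteq> 0 \<and> (\<forall>x\<in>B. g x c = 0)"
    if "finite B" "card B < 5" "\<forall>x\<in>B. \<forall>y\<in>B. x \<noteq> y \<longrightarrow> g x y = 0" "\<forall>x\<in>B. g x x \<noteq> 0" for B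
    using exists_anisotropic_orthogonal[OF nondegenerate that(1) not_spanning[OF that(1,2)]] that(3,4)
    by metis
  obtain a where a: "g a a \<noteq> 0"
    using extend[of "{}"] by auto
  obtain b where b: "g b b \<noteq> 0" "g a b = 0"
    using extend[of "{a}"] a by auto
  have "g b a = 0"
    using b by (simp add: g_sym[of b a])
  then have "\<exists>u. g u u \<noteq> 0 \<and> (\<forall>x\<in>{a, b}. g x u = 0)"
    using a b by (intro extend) (simp_all add: card_insert_if)
  then obtain u where u: "g u u \<noteq> 0" "g a u = 0" "g b u = 0"
    by blast
  then have u': "g u a = 0" "g u b = 0"
    by (simp_all add: g_sym[of u a] g_sym[of u b])
  define p where "p = br u b a"
  have p: "g p u = 0" "g p b = 0" "g p a = 0"
    using br_orthogonal[of u b a] br_orthogonal[of b a u] br_orthogonal[of a u b] br_cyclic[of u b a]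
      br_cyclic[of b a u]
    by (simp_all add: p_def)
  then have p': "g u p = 0" "g b p = 0" "g a p = 0"
    by (simp_all add: g_sym[of u p] g_sym[of b p] g_sym[of a p])
  have "g p p = - g u (br p b a)"
    unfolding p_def by (rule br_skew)
  also have "br p b a = scale (- (g a a * g b b)) u"
    unfolding p_def br_twice using u' \<open>g b a = 0\<close> b by simp
  finally have "g p p \<noteq> 0"
    using a b u by (simp add: g_right)
  then have "\<exists>c. g c c \<noteq> 0 \<and> (\<forall>x\<in>{a, b, u, p}. g x c = 0)"
    using a b \<open>g b a = 0\<close> u u' p p' by (intro extend) (simp_all add: card_insert_if)
  then obtain c where c: "g c c \<noteq> 0" "g a c = 0" "g b c = 0" "g u c = 0" "g p c = 0"
    by blast
  then have c': "g c a = 0" "g c b = 0" "g c u = 0"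
    by (simp_all add: g_sym[of c a] g_sym[of c b] g_sym[of c u])
  \<comment> \<open>The iterated binary cross product \<open>(x \<times> y) \<times> z\<close> with \<open>x \<times> y = [x, y, a]\<close>.\<close>
  define T where "T x y z = br (br x y a) z a" for x y z
  have T_swap12: "T y x z = - T x y z" for x y z
    using br_swap12[of x y a] by (simp add: T_def br_lin)
  have T_swap23: "T x z y = - T x y z" if "g x a = 0" "g y a = 0" "g z a = 0"
      "g x y = 0" "g x z = 0" "g y z = 0"
    for x y z
    using br_twice_polar[of x y a z] that by (simp add: T_def add_eq_0_iff)
  \<comment> \<open>The Jacobi identity: the derivation \<open>[c, a, \<cdot>]\<close> applied to \<open>[u, b, a]\<close>.\<close>
  have "T u b c = T u c b - T b c u"
    using nambu[of c a u b a] br_same23[of c a]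
    by (simp add: T_def br_lin br_cyclic[of c a "br u b a"] br_cyclic[of c a u] br_cyclic[of c a b]
        br_swap12[of u "br b c a" a])
  moreover have "T u c b = - T u b c"
    using u u' b c c' \<open>g b a = 0\<close> by (intro T_swap23) simp_all
  moreover have "T b c u = T u b c"
    using T_swap23[of b u c] T_swap12[of b u c] u u' b c c' \<open>g b a = 0\<close> by simp
  ultimately have "T u b c + T u b c + T u b c = 0"
    by (simp add: algebra_simps)
  then have "scale 3 (T u b c) = 0"
    using scale_left_distrib[of 1 2 "T u b c"] scale_left_distrib[of 1 1 "T u b c"]
    by (simp add: algebra_simps)
  then have "br p c a = 0"
    by (simp add: T_def p_def)
  then have "br (br p c a) c a = 0"
    by (simp add: br_lin)
  then have "p = 0"
    unfolding br_twice using c c' a p by simp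
  then show False
    using \<open>g p p \<noteq> 0\<close> by (simp add: g_left)
qed

end

section \<open>Twisting along an endomorphism\<close>

locale twisted_cross_product = ternary_cross_product scale g br
  for scale :: "'k::field_char_0 \<Rightarrow> 'v::ab_group_add \<Rightarrow> 'v" and g br +
  fixes \<alpha> :: "'v \<Rightarrow> 'v"
  assumes linear_twist: "Vector_Spaces.linear scale scale \<alpha>"
    and twist_br: "\<alpha> (br x y z) = br (\<alpha> x) (\<alpha> y) (\<alpha> z)"
begin

lemmas twist_lin = linear_homD[OF linear_twist]

lemma twist_linear_comp:
  "Vector_Spaces.linear scale scale f \<Longrightarrow> Vector_Spaces.linear scale scale (\<lambda>x. \<alpha> (f x))"
  using Vector_Spaces.linear_compose[OF _ linear_twist, of scale f] by (simp add: o_def)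

sublocale twisted: ternary_hom_maltsev_algebra scale "\<lambda>x y z. \<alpha> (br x y z)" \<alpha>
proof (intro ternary_hom_maltsev_algebra.intro ternary_hom_maltsev_algebra_axioms.intro
    antisymmetric_ternary_hom_algebra.intro antisymmetric_ternary_hom_algebra_axioms.intro
    ternary_hom_algebra.intro ternary_hom_algebra_axioms.intro vector_space_axioms)
  \<comment> \<open>Moving every \<open>\<alpha>\<close> outwards turns the right-hand side into \<open>\<alpha>\<^sup>3\<close> of the Maltsev identity.\<close>
  show "0 = \<alpha> (\<alpha> (br (\<alpha> (br z x2 x3)) (\<alpha> (br x2 y2 y3)) (\<alpha> x3)))
      + \<alpha> (\<alpha> (br (\<alpha> (br z x2 x3)) (\<alpha> x2) (\<alpha> (br x3 y2 y3))))
      + \<alpha> (br (\<alpha> (br (\<alpha> z) (\<alpha> (br x2 y2 y3)) (\<alpha> x3))) (\<alpha> (\<alpha> x2)) (\<alpha> (\<alpha> x3)))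
      + \<alpha> (br (\<alpha> (br (\<alpha> z) (\<alpha> x2) (\<alpha> (br x3 y2 y3)))) (\<alpha> (\<alpha> x2)) (\<alpha> (\<alpha> x3)))
      - \<alpha> (br (\<alpha> (br (\<alpha> (br z x2 x3)) (\<alpha> x2) (\<alpha> x3))) (\<alpha> (\<alpha> y2)) (\<alpha> (\<alpha> y3)))
      + \<alpha> (br (\<alpha> (br (\<alpha> (br z y2 y3)) (\<alpha> x2) (\<alpha> x3))) (\<alpha> (\<alpha> x2)) (\<alpha> (\<alpha> x3)))" for z x2 x3 y2 y3
    using arg_cong[OF ternary_maltsev[of z x2 x3 y2 y3], of "\<lambda>u. \<alpha> (\<alpha> (\<alpha> u))"]
    by (simp add: twist_lin flip: twist_br)
  show "\<alpha> (br (x 1) (x 2) (x 3)) = scale (of_int (sign \<sigma>)) (\<alpha> (br (x (\<sigma> 1)) (x (\<sigma> 2)) (x (\<sigma> 3))))"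
    if "\<sigma> permutes {1, 2, 3::nat}" for \<sigma> x
    using br_permute[OF that, of x] by (simp add: twist_lin)
qed (intro twist_linear_comp linear_br1 linear_br2 linear_br3 linear_twist)+

sublocale twisted: multiplicative_ternary_hom_algebra scale "\<lambda>x y z. \<alpha> (br x y z)" \<alpha>
  by unfold_locales (simp add: twist_br)

lemma twisted_not_nambu_lie:
  assumes "\<And>x. (\<And>y. g x y = 0) \<Longrightarrow> x = 0" "dim_at_least scale 5" "inj \<alpha>"
  shows "\<not> ternary_hom_nambu_lie_algebra scale (\<lambda>x y z. \<alpha> (br x y z)) \<alpha>"
proof
  assume "ternary_hom_nambu_lie_algebra scale (\<lambda>x y z. \<alpha> (br x y z)) \<alpha>"
  then interpret nambu: ternary_hom_nambu_lie_algebra scale "\<lambda>x y z. \<alpha> (br x y z)" \<alpha> .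
  have "\<alpha> (\<alpha> (br x y (br u v w))) =
    \<alpha> (\<alpha> (br (br x y u) v w + br u (br x y v) w + br u v (br x y w)))" for x y u v w
    using nambu.hom_nambu[of x y u v w] by (simp add: twist_lin flip: twist_br)
  then have "br x y (br u v w) = br (br x y u) v w + br u (br x y v) w + br u v (br x y w)"
    for x y u v w
    by (rule injD[OF \<open>inj \<alpha>\<close> injD[OF \<open>inj \<alpha>\<close>]])
  from not_nambu_lie[OF assms(1,2) this] show False .
qed

end

section \<open>The cross product of a composition algebra\<close>

context composition_algebra_with_involution
begin

abbreviation g where "g \<equiv> inner_form scale mul e ast"

lemmas mul_lin = linear_homD[OF linear_mult_left] linear_homD[OF linear_mult_right]
lemmas ast_lin = linear_homD[OF linear_ast]

lemma ast_unit: "ast e = e"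
  using ast_mult[of "ast e" e] by (simp add: ast_ast mult_unit_left mult_unit_right)

lemma g_commute: "g x y = g y x"
  by (rule inner_eqI) (simp add: scale_inner add.commute)

lemma g_linear: "Vector_Spaces.linear scale (*) (\<lambda>x. g x y)"
proof -
  have "g (x + x') y = g x y + g x' y" for x x'
    by (rule inner_eqI) (simp add: scale_left_distrib scale_inner mul_lin ast_lin scale_right_distrib)
  moreover have "g (scale c x) y = c * g x y" for c x
  proof (rule inner_eqI)
    have "scale (c * g x y) e = scale c (scale (g x y) e)"
      by simp
    also have "\<dots> = scale (1/2) (mul (scale c x) (ast y) + mul y (ast (scale c x)))"
      unfolding scale_inner by (simp add: mul_lin ast_lin scale_right_distrib)
    finally show "scale (c * g x y) e = \<dots>" .
  qed
  moreover have "vector_space ((*) :: 'k \<Rightarrow> 'k \<Rightarrow> 'k)"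
    by unfold_locales (simp_all add: algebra_simps)
  ultimately show ?thesis
    by (simp add: Vector_Spaces.linear_iff vector_space_axioms)
qed

lemmas g_left = linear_homD[OF g_linear]

lemma g_right:
  "g x (y + z) = g x y + g x z" "g x (scale c y) = c * g x y" "g x 0 = 0" "g x (- y) = - g x y"
  "g x (y - z) = g x y - g x z"
  by (simp_all add: g_commute[of x] g_left)

lemma g_eqI: "(\<And>z. g x z = g y z) \<Longrightarrow> x = y"
  using nondegenerate[of "x - y"] by (simp add: g_left)

text \<open>
  \<open>\<langle>x, e\<rangle> e\<close> is half of \<open>x + x*\<close>, so the involution is the standard conjugation; this converts
  identities for the norm into identities for the involution.
\<close>

lemma ast_eq: "ast x = scale (2 * g x e) e - x"
proof -
  have "scale (2 * g x e) e = scale 2 (scale (g x e) e)"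
    by simp
  also have "\<dots> = x + ast x"
    unfolding scale_inner by (simp add: ast_unit mult_unit_left mult_unit_right)
  finally show ?thesis
    by simp
qed

lemma mul_ast_self: "mul x (ast x) = scale (g x x) e"
proof -
  have "scale (1/2) (mul x (ast x) + mul x (ast x)) = scale (1/2 + 1/2) (mul x (ast x))"
    by (simp only: scale_left_distrib scale_right_distrib)
  then show ?thesis
    unfolding scale_inner by simp
qed

lemma g_ast: "g (ast x) (ast y) = g x y"
proof -
  have "g (ast x) (ast x) = g x x" for x
  proof (rule inner_eqI)
    have "scale (g x x) e = scale (1/2) (mul x (ast x) + mul x (ast x))"
      by (rule scale_inner)
    then show "scale (g x x) e = scale (1/2) (mul (ast x) (ast (ast x)) + mul (ast x) (ast (ast x)))"
      by (simp add: ast_ast mult_ast_commute)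
  qed
  from this[of "x + y"] this[of x] this[of y]
  have "2 * g (ast x) (ast y) = 2 * g x y"
    by (simp add: ast_lin g_left g_right g_commute)
  then show ?thesis
    by simp
qed

lemma g_mul_left: "g (mul x a) (mul x b) = g x x * g a b"
proof -
  have "2 * g (mul x a) (mul x b) = g (mul x (a + b)) (mul x (a + b))
      - g (mul x a) (mul x a) - g (mul x b) (mul x b)"
    by (simp add: mul_lin g_left g_right g_commute)
  also have "\<dots> = 2 * (g x x * g a b)"
    unfolding composition by (simp add: g_left g_right g_commute algebra_simps)
  finally show ?thesis
    by simp
qed

lemma g_mul_right: "g (mul a x) (mul b x) = g a b * g x x"
proof -
  have "2 * g (mul a x) (mul b x) = g (mul (a + b) x) (mul (a + b) x)
      - g (mul a x) (mul a x) - g (mul b x) (mul b x)"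
    by (simp add: mul_lin g_left g_right g_commute)
  also have "\<dots> = 2 * (g a b * g x x)"
    unfolding composition by (simp add: g_left g_right g_commute algebra_simps)
  finally show ?thesis
    by simp
qed

text \<open>
  The full linearization of the multiplicativity of the norm in all four arguments.
\<close>

lemma g_mul_exchange: "g (mul x a) (mul y b) + g (mul x b) (mul y a) = 2 * g x y * g a b"
proof -
  have "g (mul x (a + b)) (mul y (a + b)) = g x y * g (a + b) (a + b)"
    by (rule g_mul_right)
  then show ?thesis
    by (simp add: mul_lin g_left g_right g_mul_right g_commute algebra_simps)
qed

text \<open>
  Put \<open>e\<close> for one argument in \<open>g_mul_exchange\<close>.
\<close>

lemma g_adjoint_right: "g (mul x y) z = g x (mul z (ast y))"
  using g_mul_exchange[of x y z e]
  by (simp add: mult_unit_left mult_unit_right ast_eq[of y] mul_lin g_right algebra_simps)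

text \<open>
  This is right alternativity in disguise.  Pairing with \<open>z\<close> and moving \<open>c*\<close> to the other side
  gives \<open>\<langle>x c, z c\<rangle>\<close>, which multiplicativity of the norm evaluates.
\<close>

lemma mul_mul_ast: "mul (mul x c) (ast c) = scale (g c c) x"
proof (rule g_eqI)
  fix z
  show "g (mul (mul x c) (ast c)) z = g (scale (g c c) x) z"
    by (simp add: g_adjoint_right[of "mul x c"] ast_ast g_mul_right g_left)
qed

lemma mul_ast_mul: "mul (mul x (ast c)) c = scale (g c c) x"
  using mul_mul_ast[of x "ast c"] by (simp add: ast_ast g_ast)

lemma mul_mul_ast_polar: "mul (mul x b) (ast a) = scale (2 * g a b) x - mul (mul x a) (ast b)"
proof -
  have "mul (mul x (a + b)) (ast (a + b)) = scale (g (a + b) (a + b)) x"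
    by (rule mul_mul_ast)
  then have "mul (mul x b) (ast a) + mul (mul x a) (ast b) = scale (2 * g a b) x"
    by (simp add: mul_lin ast_lin g_left g_right mul_mul_ast g_commute[of b a] scale_left_distrib
        add.commute)
  then show ?thesis
    by (simp only: eq_diff_eq)
qed

lemma mul_ast_mul_polar: "mul (mul x (ast b)) a = scale (2 * g a b) x - mul (mul x (ast a)) b"
  using mul_mul_ast_polar[of x "ast b" "ast a"] by (simp add: ast_ast g_ast)

abbreviation triple where "triple \<equiv> twisted_bracket scale mul e ast id"

lemma triple_eq: "triple x y z =
    mul (mul x (ast y)) z - scale (g y z) x + scale (g x z) y - scale (g x y) z"
  by (simp add: twisted_bracket_def)

lemma triple_same12: "triple x x z = 0"
  by (simp add: triple_eq mul_ast_self mul_lin mult_unit_left)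

lemma triple_same23: "triple x y y = 0"
  by (simp add: triple_eq mul_ast_mul)

text \<open>
  The terms with two factors from the form cancel, and
  \<open>\<langle>(x y*) z, x\<rangle> = \<langle>x y*, x z*\<rangle> = \<langle>x, x\<rangle> \<langle>y, z\<rangle>\<close>.
\<close>

lemma triple_orthogonal: "g (triple x y z) x = 0"
  by (simp add: triple_eq g_left g_adjoint_right[of _ z] g_mul_left g_ast g_commute[of y x]
      g_commute[of z x])

text \<open>
  For \<open>br_twice\<close> let \<open>P u = (u a*) b\<close>.  On vectors orthogonal to \<open>a\<close> and \<open>b\<close>, in particular on
  \<open>[z, a, b]\<close>, the operator \<open>[\<cdot>, a, b]\<close> is \<open>P - \<langle>a, b\<rangle>\<close>.  The operator \<open>P\<close> satisfies the
  quadratic equation \<open>P\<^sup>2 = 2 \<langle>a, b\<rangle> P - \<langle>a, a\<rangle> \<langle>b, b\<rangle>\<close>, so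
  \<open>(P - \<langle>a, b\<rangle>)\<^sup>2\<close> is minus the Gram determinant.  For a
  vector \<open>z\<close> with components along \<open>a\<close> and \<open>b\<close>, the other terms come from \<open>P a\<close> and \<open>P b\<close>.
\<close>

sublocale cross: ternary_cross_product scale g triple
proof (intro ternary_cross_product.intro ternary_cross_product_axioms.intro vector_space_axioms)
  show "Vector_Spaces.linear scale (*) (\<lambda>x. g x y)" for y
    by (rule g_linear)
  show "Vector_Spaces.linear scale scale (\<lambda>x. triple x y z)" for y z
    by (simp add: Vector_Spaces.linear_iff vector_space_axioms triple_eq mul_lin g_left
        scale_left_distrib scale_right_distrib scale_right_diff_distrib algebra_simps)
  show "Vector_Spaces.linear scale scale (\<lambda>y. triple x y z)" for x z
    by (simp add: Vector_Spaces.linear_iff vector_space_axioms triple_eq mul_lin ast_lin g_left g_right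
        scale_left_distrib scale_right_distrib scale_right_diff_distrib algebra_simps)
  show "Vector_Spaces.linear scale scale (\<lambda>z. triple x y z)" for x y
    by (simp add: Vector_Spaces.linear_iff vector_space_axioms triple_eq mul_lin g_right
        scale_left_distrib scale_right_distrib scale_right_diff_distrib algebra_simps)
  show "triple (triple z a b) a b =
      scale (g a b * g a b - g a a * g b b) z
      + scale (g z a * g b b - g z b * g a b) a
      + scale (g z b * g a a - g z a * g a b) b" for z a b
  proof -
    define P where "P u = mul (mul u (ast a)) b" for u
    have triple_P: "triple u a b = P u - scale (g a b) u + scale (g u b) a - scale (g u a) b" for u
      by (simp add: triple_eq P_def)
    have P_lin: "P (u + v) = P u + P v" "P (u - v) = P u - P v" "P (scale c u) = scale c (P u)"
      for u v c
      by (simp_all add: P_def mul_lin)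
    have P_a: "P a = scale (g a a) b"
      by (simp add: P_def mul_ast_self mul_lin mult_unit_left)
    have P_b: "P b = scale (2 * g a b) b - scale (g b b) a"
      using mul_ast_mul_polar[of b a b]
      by (simp add: P_def mul_ast_self mul_lin mult_unit_left g_commute)
    \<comment> \<open>Exchange \<open>b\<close> and \<open>a*\<close> in \<open>(((z a*) b) a*) b\<close> by polarization; then \<open>(z a*) a\<close> and
      \<open>(z b*) b\<close> collapse to multiples of \<open>z\<close>.\<close>
    have P_P: "P (P z) = scale (2 * g a b) (P z) - scale (g a a * g b b) z"
      by (simp add: P_def mul_mul_ast_polar[of "mul z (ast a)" b a] mul_ast_mul mul_lin
          mult.commute)
    have "g (P z) b = g b b * g z a"
      using g_mul_right[of "mul z (ast a)" b e]
      by (simp add: P_def mult_unit_left g_adjoint_right[of z] ast_ast)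
    moreover have "g (P z) a = 2 * g z a * g a b - g a a * g z b"
      using g_mul_exchange[of z "ast a" a "ast b"]
      by (simp add: P_def g_adjoint_right[of _ b] g_adjoint_right[of z "ast b" e] mul_ast_self g_right
          g_ast ast_ast mult_unit_left algebra_simps)
    ultimately have orth: "g (triple z a b) a = 0" "g (triple z a b) b = 0"
      by (simp_all add: triple_P g_left g_commute[of b a])
    have double: "scale (2 * c) v = scale c v + scale c v" for c v
      using scale_left_distrib[of c c v] by simp
    have "triple (triple z a b) a b = P (triple z a b) - scale (g a b) (triple z a b)"
      unfolding triple_P[of "triple z a b"] orth by simp
    also have "\<dots> = scale (g a b * g a b - g a a * g b b) z
      + scale (g z a * g b b - g z b * g a b) a
      + scale (g z b * g a a - g z a * g a b) b"
      unfolding triple_P[of z] P_lin P_a P_b P_P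
      by (simp add: double scale_left_distrib scale_left_diff_distrib scale_right_distrib
          scale_right_diff_distrib algebra_simps)
    finally show ?thesis .
  qed
qed (fact g_commute triple_same12 triple_same23 triple_orthogonal)+

end

section \<open>Twisted composition algebras\<close>

theorem corollary5p9:
  fixes scale :: "'k::field_char_0 \<Rightarrow> 'a::ab_group_add \<Rightarrow> 'a"
    and mul :: "'a \<Rightarrow> 'a \<Rightarrow> 'a" and e :: 'a
    and ast :: "'a \<Rightarrow> 'a" and \<alpha> :: "'a \<Rightarrow> 'a"
  assumes "composition_algebra_with_involution scale mul e ast"
    and "unital_involutive_morphism scale mul e ast \<alpha>"
  shows "ternary_hom_maltsev_algebra scale (twisted_bracket scale mul e ast \<alpha>) \<alpha>
    \<and> multiplicative_ternary_hom_algebra scale (twisted_bracket scale mul e ast \<alpha>) \<alpha>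
    \<and> (dim_at_least scale 5 \<and> inj \<alpha> \<longrightarrow>
        \<not> ternary_hom_nambu_lie_algebra scale (twisted_bracket scale mul e ast \<alpha>) \<alpha>)"
proof -
  interpret composition_algebra_with_involution scale mul e ast by fact
  interpret morphism: unital_involutive_morphism scale mul e ast \<alpha> by fact
  note \<alpha>_lin = linear_homD[OF morphism.linear_morph]
  have isometry: "g (\<alpha> x) (\<alpha> y) = g x y" for x y
  proof (rule inner_eqI)
    have "scale (g x y) e = \<alpha> (scale (g x y) e)"
      by (simp add: \<alpha>_lin morphism.morph_unit)
    then show "scale (g x y) e = scale (1/2) (mul (\<alpha> x) (ast (\<alpha> y)) + mul (\<alpha> y) (ast (\<alpha> x)))"
      unfolding scale_inner by (simp add: \<alpha>_lin morphism.morph_mult morphism.morph_ast)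
  qed
  interpret twisted_cross_product scale g triple \<alpha>
    by unfold_locales
      (simp_all add: morphism.linear_morph triple_eq \<alpha>_lin morphism.morph_mult morphism.morph_ast isometry)
  have bracket: "twisted_bracket scale mul e ast \<alpha> = (\<lambda>x y z. \<alpha> (triple x y z))"
    by (simp add: fun_eq_iff twisted_bracket_def \<alpha>_lin)
  show ?thesis
    unfolding bracket
    using twisted.ternary_hom_maltsev_algebra_axioms
      twisted.multiplicative_ternary_hom_algebra_axioms twisted_not_nambu_lie nondegenerate
    by blast
qed

end
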